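(* Let $\mathcal{Z}=\mathbb{R}^r$, $\mathcal{X}=\mathbb{R}^N$, and let $e\in C^1(\mathcal{X},\mathcal{Z})$ and $d\in C^1(\mathcal{Z},\mathcal{X})$ satisfy $e(d(\zeta))=\zeta$ for all $\zeta\in\mathcal{Z}$. Put $\tilde{\mathcal{X}}:=d(\mathcal{Z})$. Let a nonlinear port-Hamiltonian system on $\mathcal{Z}$ with data $(J,R,B,\mathcal{H})$ be given, and suppose its Hamiltonian is bounded from below: there is $\mathcal{H}_{\min}\in\mathbb{R}$ with $\mathcal{H}(\zeta)\ge\mathcal{H}_{\min}$ for all $\zeta\in\mathcal{Z}$. Then the reconstructed port-Hamiltonian system on $\tilde{\mathcal{X}}$ (defined in the context) with reconstructed Hamiltonian $\bar{\mathcal{H}}=\mathcal{H}\circ e$ is passive with storage function $$\bar S:\tilde{\mathcal{X}}\to\mathbb{R},\qquad \bar S(\xi)=\bar{\mathcal{H}}(\xi)-\mathcal{H}_{\min}.$$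
   Context: $\mathcal{T}=[0,t_{\mathrm{end}}]$ with $t_{\mathrm{end}}>0$; $u:\mathcal{T}\to\mathbb{R}^p$ is an arbitrary input signal; $Dd(\zeta)\in\mathbb{R}^{N\times r}$ is the Jacobian of $d$ at $\zeta$. A nonlinear port-Hamiltonian (pH) system on $\mathcal{Z}$ consists of a differentiable function $\mathcal{H}:\mathcal{Z}\to\mathbb{R}$ (the Hamiltonian) and continuous maps $J,R:\mathcal{Z}\to\mathbb{R}^{r\times r}$, $B:\mathcal{Z}\to\mathbb{R}^{r\times p}$ with $J(\zeta)=-J(\zeta)^{\top}$ and $R(\zeta)=R(\zeta)^{\top}\succeq 0$ for all $\zeta\in\mathcal{Z}$; it is the system $$\dot z(t)=\big(J(z(t))-R(z(t))\big)\nabla\mathcal{H}(z(t))+B(z(t))\,u(t),\quad z(0)=z_0,\qquad y(t)=B(z(t))^{\top}\nabla\mathcal{H}(z(t)).$$ The reconstructed pH system on $\tilde{\mathcal{X}}$ is $$\dot{\tilde x}(t)=\big(\bar J(\tilde x(t))-\bar R(\tilde x(t))\big)\nabla\bar{\mathcal{H}}(\tilde x(t))+\bar B(\tilde x(t))\,u(t),\quad \tilde x(0)=\tilde x_0=d(z_0),\qquad \bar y(t)=\bar B(\tilde x(t))^{\top}\nabla\bar{\mathcal{H}}(\tilde x(t)),$$ with trajectories $\tilde x(t)\in\tilde{\mathcal{X}}$, $\bar{\mathcal{H}}=\mathcal{H}\circ e$ (gradient taken in $\mathbb{R}^N$), and, for $\xi=d(\zeta)$, $\bar J(\xi)=Dd(\zeta)J(\zeta)Dd(\zeta)^{\top}$,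 $\bar R(\xi)=Dd(\zeta)R(\zeta)Dd(\zeta)^{\top}$, $\bar B(\xi)=Dd(\zeta)B(\zeta)$. Its trajectories are the reconstructions $\tilde x(t)=d(z(t))$ of solutions $z$ of the system on $\mathcal{Z}$. A system with state $\tilde x(t)\in\tilde{\mathcal{X}}$, input $u$ and output $\bar y$ is called passive with storage function $S:\tilde{\mathcal{X}}\to\mathbb{R}$ if (i) $S(\xi)\ge0$ for all $\xi\in\tilde{\mathcal{X}}$ and (ii) the dissipation inequality $\frac{\mathrm{d}}{\mathrm{d}t}S(\tilde x(t))\le u(t)^{\top}\bar y(t)$ holds for all $t\in\mathcal{T}$ along its solutions. Solutions are differentiable functions satisfying the equations for all $t\in\mathcal{T}$. *)

theory Defs
  imports "HOL-Analysis.Analysis"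
begin

definition grad :: "('a::real_inner \<Rightarrow> real) \<Rightarrow> 'a \<Rightarrow> 'a" where
  "grad f x = (THE g. GDERIV f x :> g)"

definition C1_map :: "(real^'m \<Rightarrow> real^'n) \<Rightarrow> bool" where
  "C1_map f \<longleftrightarrow> (\<forall>x. f differentiable (at x)) \<and> continuous_on UNIV (\<lambda>x. jacobian f (at x))"

definition pos_semidef :: "real^'n^'n \<Rightarrow> bool" where
  "pos_semidef A \<longleftrightarrow> transpose A = A \<and> (\<forall>v. 0 \<le> v \<bullet> (A *v v))"

definition ph_system ::
  "(real^'r \<Rightarrow> real^'r^'r) \<Rightarrow> (real^'r \<Rightarrow> real^'r^'r) \<Rightarrow> (real^'r \<Rightarrow> real^'p^'r) \<Rightarrow> (real^'r \<Rightarrow> real) \<Rightarrow> bool"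
where
  "ph_system J R B H \<longleftrightarrow>
     (\<forall>\<zeta>. H differentiable (at \<zeta>)) \<and>
     continuous_on UNIV J \<and> continuous_on UNIV R \<and> continuous_on UNIV B \<and>
     (\<forall>\<zeta>. J \<zeta> = - transpose (J \<zeta>)) \<and> (\<forall>\<zeta>. pos_semidef (R \<zeta>))"

definition ph_rhs ::
  "(real^'n \<Rightarrow> real^'n^'n) \<Rightarrow> (real^'n \<Rightarrow> real^'n^'n) \<Rightarrow> (real^'n \<Rightarrow> real^'p^'n) \<Rightarrow> (real^'n \<Rightarrow> real)
     \<Rightarrow> real^'n \<Rightarrow> real^'p \<Rightarrow> real^'n"
where
  "ph_rhs J R B H x v = (J x - R x) *v grad H x + B x *v v"

definition ph_output :: "(real^'n \<Rightarrow> real^'p^'n) \<Rightarrow> (real^'n \<Rightarrow> real) \<Rightarrow> real^'n \<Rightarrow> real^'p" where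
  "ph_output B H x = transpose (B x) *v grad H x"

text \<open>
  The derivative is taken within the time set \<open>T\<close>, hence is one-sided at the end points of a
  compact interval. Only the values of \<open>u\<close> and \<open>x\<close> on \<open>T\<close> matter.
\<close>
definition ode_solution ::
  "real set \<Rightarrow> 'x set \<Rightarrow> ('x \<Rightarrow> 'u \<Rightarrow> 'x) \<Rightarrow> (real \<Rightarrow> 'u) \<Rightarrow> 'x \<Rightarrow> (real \<Rightarrow> 'x::real_normed_vector) \<Rightarrow> bool"
where
  "ode_solution T X f u x0 x \<longleftrightarrow>
     x 0 = x0 \<and>
     (\<forall>t\<in>T. x t \<in> X \<and> (x has_vector_derivative f (x t) (u t)) (at t within T))"

text \<open>
  Passivity with storage function \<open>S\<close> of the system \<open>x' = f x u\<close>, \<open>y = h x\<close> with states in \<open>X\<close>: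
  \<open>u\<close> ranges over all input signals and \<open>x0\<close> over all initial states. That \<open>S\<close> is differentiable
  along solutions is part of the dissipation inequality.
\<close>
definition is_passive ::
  "real set \<Rightarrow> 'x::real_normed_vector set \<Rightarrow> ('x \<Rightarrow> 'u::real_inner \<Rightarrow> 'x) \<Rightarrow> ('x \<Rightarrow> 'u) \<Rightarrow> ('x \<Rightarrow> real) \<Rightarrow> bool"
where
  "is_passive T X f h S \<longleftrightarrow>
     (\<forall>\<xi>\<in>X. 0 \<le> S \<xi>) \<and>
     (\<forall>u x0 x. x0 \<in> X \<longrightarrow> ode_solution T X f u x0 x \<longrightarrow>
        (\<forall>t\<in>T. \<exists>D. ((\<lambda>s. S (x s)) has_real_derivative D) (at t within T) \<and> D \<le> u t \<bullet> h (x t)))"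

text \<open>
  Reconstructed data: if \<open>e\<close> is a left inverse of \<open>d\<close>, then \<open>\<zeta> = e \<xi>\<close> is the unique preimage
  of a point \<open>\<xi> = d \<zeta>\<close> of \<open>range d\<close>. Values off \<open>range d\<close> are irrelevant.
\<close>
definition recon_matrix ::
  "(real^'N \<Rightarrow> real^'r) \<Rightarrow> (real^'r \<Rightarrow> real^'N) \<Rightarrow> (real^'r \<Rightarrow> real^'r^'r) \<Rightarrow> real^'N \<Rightarrow> real^'N^'N"
where
  "recon_matrix e d A \<xi> =
     (let \<zeta> = e \<xi>; D = jacobian d (at \<zeta>) in D ** A \<zeta> ** transpose D)"

definition recon_input ::
  "(real^'N \<Rightarrow> real^'r) \<Rightarrow> (real^'r \<Rightarrow> real^'N) \<Rightarrow> (real^'r \<Rightarrow> real^'p^'r) \<Rightarrow> real^'N \<Rightarrow> real^'p^'N"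
where
  "recon_input e d B \<xi> = (let \<zeta> = e \<xi> in jacobian d (at \<zeta>) ** B \<zeta>)"

abbreviation recon_rhs ::
  "(real^'N \<Rightarrow> real^'r) \<Rightarrow> (real^'r \<Rightarrow> real^'N) \<Rightarrow> (real^'r \<Rightarrow> real^'r^'r) \<Rightarrow> (real^'r \<Rightarrow> real^'r^'r)
     \<Rightarrow> (real^'r \<Rightarrow> real^'p^'r) \<Rightarrow> (real^'r \<Rightarrow> real) \<Rightarrow> real^'N \<Rightarrow> real^'p \<Rightarrow> real^'N"
where
  "recon_rhs e d J R B H \<equiv>
     ph_rhs (recon_matrix e d J) (recon_matrix e d R) (recon_input e d B) (H \<circ> e)"

abbreviation recon_output ::
  "(real^'N \<Rightarrow> real^'r) \<Rightarrow> (real^'r \<Rightarrow> real^'N) \<Rightarrow> (real^'r \<Rightarrow> real^'p^'r) \<Rightarrow> (real^'r \<Rightarrow> real)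
     \<Rightarrow> real^'N \<Rightarrow> real^'p"
where
  "recon_output e d B H \<equiv> ph_output (recon_input e d B) (H \<circ> e)"

lemma grad_eqI:
  assumes "GDERIV f x :> g"
  shows "grad f x = g"
  unfolding grad_def
proof (rule the_equality)
  fix g' assume "GDERIV f x :> g'"
  with assms have "(\<lambda>h. h \<bullet> g') = (\<lambda>h. h \<bullet> g)"
    unfolding gderiv_def by (rule has_derivative_unique[rotated])
  then show "g' = g" by (metis vector_eq_ldot)
qed (fact assms)

lemma GDERIV_grad:
  fixes f :: "'a::euclidean_space \<Rightarrow> real"
  assumes "f differentiable (at x)"
  shows "GDERIV f x :> grad f x"
proof -
  from assms obtain f' where f': "(f has_derivative f') (at x)"
    by (auto simp: differentiable_def)
  have "f' = (\<lambda>h. h \<bullet> adjoint f' 1)"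
    using adjoint_works[OF has_derivative_linear[OF f'], of _ 1] by auto
  with f' have "GDERIV f x :> adjoint f' 1" by (simp add: gderiv_def)
  then show ?thesis using grad_eqI by metis
qed

lemma grad_comp:
  fixes e :: "real^'N \<Rightarrow> real^'r" and H :: "real^'r \<Rightarrow> real"
  assumes "e differentiable (at x)" "H differentiable (at (e x))"
  shows "grad (H \<circ> e) x = transpose (jacobian e (at x)) *v grad H (e x)"
proof (rule grad_eqI)
  have "(e has_derivative (\<lambda>h. jacobian e (at x) *v h)) (at x)"
    using assms(1) jacobian_works by blast
  moreover have "(H has_derivative (\<lambda>h. h \<bullet> grad H (e x))) (at (e x))"
    using GDERIV_grad[OF assms(2)] by (simp add: gderiv_def)
  ultimately have "(H \<circ> e has_derivative (\<lambda>h. (jacobian e (at x) *v h) \<bullet> grad H (e x))) (at x)"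
    using diff_chain_at[of e _ x H] by (simp add: o_def)
  moreover have "(jacobian e (at x) *v h) \<bullet> grad H (e x)
      = h \<bullet> (transpose (jacobian e (at x)) *v grad H (e x))" for h
    using dot_lmul_matrix[of "grad H (e x)" "jacobian e (at x)" h] by (simp add: inner_commute)
  ultimately show "GDERIV (H \<circ> e) x :> transpose (jacobian e (at x)) *v grad H (e x)"
    by (simp only: gderiv_def)
qed

lemma jacobian_left_inverse:
  fixes e :: "real^'N \<Rightarrow> real^'r" and d :: "real^'r \<Rightarrow> real^'N"
  assumes "e differentiable (at (d z))" "d differentiable (at z)" "\<forall>\<zeta>. e (d \<zeta>) = \<zeta>"
  shows "jacobian e (at (d z)) ** jacobian d (at z) = mat 1"
proof -
  have "(d has_derivative (\<lambda>h. jacobian d (at z) *v h)) (at z)"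
    "(e has_derivative (\<lambda>h. jacobian e (at (d z)) *v h)) (at (d z))"
    using assms jacobian_works by blast+
  then have "(e \<circ> d has_derivative (\<lambda>h. jacobian e (at (d z)) *v (jacobian d (at z) *v h))) (at z)"
    using diff_chain_at[of d _ z e] by (simp add: o_def)
  moreover have "e \<circ> d = (\<lambda>x. x)" using assms by auto
  ultimately have "((\<lambda>x. x) has_derivative
      (\<lambda>h. jacobian e (at (d z)) *v (jacobian d (at z) *v h))) (at z)" by (simp only:)
  from has_derivative_unique[OF this has_derivative_ident]
  have "jacobian e (at (d z)) *v (jacobian d (at z) *v h) = h" for h by (rule fun_cong)
  then show ?thesis by (simp add: matrix_eq matrix_vector_mul_assoc)
qed

lemma recon_rhs_decoder:
  assumes e: "\<forall>x. e differentiable (at x)" and d: "\<forall>x. d differentiable (at x)"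
    and ed: "\<forall>\<zeta>. e (d \<zeta>) = \<zeta>" and H: "\<forall>x. H differentiable (at x)"
  shows "recon_rhs e d J R B H (d z) v = jacobian d (at z) *v ph_rhs J R B H z v"
proof -
  let ?D = "jacobian d (at z)" and ?E = "jacobian e (at (d z))"
  have "transpose ?D *v grad (H \<circ> e) (d z) = (transpose ?D ** transpose ?E) *v grad H z"
    using e H ed by (simp add: grad_comp matrix_vector_mul_assoc del: transpose_matrix_vector)
  also have "transpose ?D ** transpose ?E = mat 1"
    by (simp only: matrix_transpose_mul[symmetric] transpose_mat
        jacobian_left_inverse[OF spec[OF e] spec[OF d] ed])
  finally have g: "transpose ?D *v grad (H \<circ> e) (d z) = grad H z" by (simp only: matrix_vector_mul_lid)
  have A: "recon_matrix e d A (d z) *v grad (H \<circ> e) (d z) = ?D *v (A z *v grad H z)" for A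
    by (simp only: recon_matrix_def Let_def spec[OF ed] matrix_vector_mul_assoc[symmetric] g)
  have Bv: "recon_input e d B (d z) *v v = ?D *v (B z *v v)"
    by (simp only: recon_input_def Let_def spec[OF ed] matrix_vector_mul_assoc[symmetric])
  have "recon_rhs e d J R B H (d z) v
      = ?D *v (J z *v grad H z) - ?D *v (R z *v grad H z) + ?D *v (B z *v v)"
    by (simp only: ph_rhs_def matrix_vector_mult_diff_rdistrib A Bv)
  also have "\<dots> = ?D *v ph_rhs J R B H z v"
    by (simp only: ph_rhs_def matrix_vector_mult_diff_rdistrib matrix_vector_mult_diff_distrib
        matrix_vector_right_distrib)
  finally show ?thesis .
qed

text \<open>
  The solutions in \<open>range d\<close> of the reconstructed equations are exactly the reconstructions
  \<open>d (z t)\<close> of solutions \<open>z\<close> of the port-Hamiltonian system on the latent space, so quantifying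
  over the former in \<^const>\<open>is_passive\<close> is quantifying over the latter.
\<close>
lemma recon_trajectories:
  assumes "C1_map e" "C1_map d" and ed: "\<forall>\<zeta>. e (d \<zeta>) = \<zeta>" and "ph_system J R B H"
    and "0 \<in> T"
  shows "ode_solution T (range d) (recon_rhs e d J R B H) u (d z0) x \<longleftrightarrow>
         (\<exists>z. ode_solution T UNIV (ph_rhs J R B H) u z0 z \<and> (\<forall>t\<in>T. x t = d (z t)))"
    (is "?L \<longleftrightarrow> ?R")
proof -
  have e: "\<forall>x. e differentiable (at x)" and d: "\<forall>x. d differentiable (at x)"
    and H: "\<forall>x. H differentiable (at x)"
    using assms by (auto simp: C1_map_def ph_system_def)
  note rhs = recon_rhs_decoder[OF e d ed H]
  have De: "(e has_derivative (\<lambda>h. jacobian e (at a) *v h)) (at a)" for a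
    using iffD1[OF jacobian_works spec[OF e]] .
  have Dd: "(d has_derivative (\<lambda>h. jacobian d (at a) *v h)) (at a)" for a
    using iffD1[OF jacobian_works spec[OF d]] .
  show ?thesis
  proof
    assume L: ?L
    have "ode_solution T UNIV (ph_rhs J R B H) u z0 (\<lambda>t. e (x t))"
      unfolding ode_solution_def
    proof (intro conjI ballI)
      show "e (x 0) = z0" using L ed by (simp add: ode_solution_def)
      fix t assume t: "t \<in> T"
      then obtain z where z: "x t = d z" using L by (auto simp: ode_solution_def)
      have "(x has_vector_derivative (jacobian d (at z) *v ph_rhs J R B H z (u t))) (at t within T)"
        using bspec[OF conjunct2[OF L[unfolded ode_solution_def]] t] by (simp only: z rhs)
      from vector_derivative_diff_chain_within[OF this has_derivative_at_withinI[OF De]]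
      have "(e \<circ> x has_vector_derivative
          jacobian e (at (d z)) *v (jacobian d (at z) *v ph_rhs J R B H z (u t))) (at t within T)"
        by (simp add: z)
      also have "jacobian e (at (d z)) *v (jacobian d (at z) *v ph_rhs J R B H z (u t))
          = ph_rhs J R B H z (u t)"
        by (simp only: matrix_vector_mul_assoc jacobian_left_inverse[OF spec[OF e] spec[OF d] ed]
            matrix_vector_mul_lid)
      finally show "((\<lambda>t. e (x t)) has_vector_derivative ph_rhs J R B H (e (x t)) (u t)) (at t within T)"
        by (simp add: z ed o_def)
    qed simp
    moreover have "\<forall>t\<in>T. x t = d (e (x t))"
      using L ed by (auto simp: ode_solution_def)
    ultimately show ?R by blast
  next
    assume ?R
    then obtain z where z: "ode_solution T UNIV (ph_rhs J R B H) u z0 z"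
      and x: "\<forall>t\<in>T. x t = d (z t)" by blast
    show ?L
      unfolding ode_solution_def
    proof (intro conjI ballI)
      show "x 0 = d z0" using x z \<open>0 \<in> T\<close> by (simp add: ode_solution_def)
      fix t assume t: "t \<in> T"
      then show "x t \<in> range d" using x by simp
      have "(z has_vector_derivative ph_rhs J R B H (z t) (u t)) (at t within T)"
        using z t by (simp add: ode_solution_def)
      from vector_derivative_diff_chain_within[OF this has_derivative_at_withinI[OF Dd]]
      have "((\<lambda>t. d (z t)) has_vector_derivative recon_rhs e d J R B H (x t) (u t)) (at t within T)"
        using x t by (simp add: o_def[of d z] rhs)
      then show "(x has_vector_derivative recon_rhs e d J R B H (x t) (u t)) (at t within T)"
        by (rule has_vector_derivative_transform[OF t, rotated]) (simp add: x)
    qed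
  qed
qed

end

theory Submission
  imports Defs
begin

text \<open>
  The reconstructed system is itself port-Hamiltonian at every point of \<open>range d\<close>: congruence by
  the Jacobian of \<open>d\<close> preserves skew-symmetry and positive semidefiniteness, and
  \<open>H \<circ> e\<close> is differentiable by the chain rule. Passivity is then the usual power balance:
  along a solution, the derivative of the Hamiltonian is the inner product of its gradient \<open>g\<close> with
  the right-hand side, in which \<open>g \<bullet> J g = 0\<close>, \<open>- g \<bullet> R g \<le> 0\<close>, and
  \<open>g \<bullet> B u = u \<bullet> B\<^sup>T g\<close> is the supplied power (\<open>ph_power_balance\<close>, \<open>ph_passive\<close>).
\<close>

lemma inner_transpose_mult:
  fixes A :: "real^'n^'m"
  shows "x \<bullet> (transpose A *v y) = (A *v x) \<bullet> y"
  using dot_lmul_matrix[of y A x] by (simp add: inner_commute)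

lemma skew_quadratic_form:
  fixes A :: "real^'n^'n"
  assumes "A = - transpose A"
  shows "v \<bullet> (A *v v) = 0"
proof -
  have "A *v v = - (transpose A *v v)"
    by (subst assms) (simp add: vec_eq_iff matrix_vector_mult_def sum_negf)
  then have "v \<bullet> (A *v v) = - ((A *v v) \<bullet> v)"
    by (simp only: inner_minus_right inner_transpose_mult)
  then show ?thesis by (simp add: inner_commute)
qed

lemma congruence_quadratic_form:
  fixes D :: "real^'n^'m" and A :: "real^'n^'n"
  shows "v \<bullet> ((D ** A ** transpose D) *v v)
    = (transpose D *v v) \<bullet> (A *v (transpose D *v v))"
  using inner_transpose_mult[of v "transpose D" "A *v (transpose D *v v)"]
  by (simp only: matrix_vector_mul_assoc[symmetric] transpose_transpose)

lemma ph_power_balance: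
  fixes J R :: "real^'n \<Rightarrow> real^'n^'n"
  assumes "grad H x \<bullet> (J x *v grad H x) = 0" and "0 \<le> grad H x \<bullet> (R x *v grad H x)"
  shows "ph_rhs J R B H x v \<bullet> grad H x \<le> v \<bullet> ph_output B H x"
proof -
  have "ph_rhs J R B H x v \<bullet> grad H x
      = grad H x \<bullet> (J x *v grad H x) - grad H x \<bullet> (R x *v grad H x) + v \<bullet> ph_output B H x"
    by (simp only: ph_rhs_def ph_output_def matrix_vector_mult_diff_rdistrib inner_transpose_mult
        inner_add_right inner_diff_right inner_commute[of _ "grad H x"])
  with assms show ?thesis by linarith
qed

text \<open>
  Skew-symmetry and semidefiniteness are expressed by the quadratic forms of \<open>J\<close> and \<open>R\<close>, because
  these are the quantities that a congruence transforms and that occur in the power balance.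
\<close>
lemma ph_passive:
  fixes J R :: "real^'n \<Rightarrow> real^'n^'n"
  assumes H: "\<And>x. x \<in> X \<Longrightarrow> H differentiable (at x)"
    and J: "\<And>x v. x \<in> X \<Longrightarrow> v \<bullet> (J x *v v) = 0"
    and R: "\<And>x v. x \<in> X \<Longrightarrow> 0 \<le> v \<bullet> (R x *v v)"
    and c: "\<And>x. x \<in> X \<Longrightarrow> c \<le> H x"
  shows "is_passive T X (ph_rhs J R B H) (ph_output B H) (\<lambda>x. H x - c)"
  unfolding is_passive_def
proof (intro conjI ballI allI impI)
  fix \<xi> assume "\<xi> \<in> X"
  then show "0 \<le> H \<xi> - c" using c by simp
next
  fix u x0 x t
  assume "ode_solution T X (ph_rhs J R B H) u x0 x" and t: "t \<in> T"
  then have X: "x t \<in> X"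
    and x: "(x has_vector_derivative ph_rhs J R B H (x t) (u t)) (at t within T)"
    by (auto simp: ode_solution_def)
  let ?D = "ph_rhs J R B H (x t) (u t) \<bullet> grad H (x t)"
  have "(H has_derivative (\<lambda>h. h \<bullet> grad H (x t))) (at (x t) within x ` T)"
    using GDERIV_grad[OF H[OF X]] by (auto simp: gderiv_def intro: has_derivative_at_withinI)
  from vector_derivative_diff_chain_within[OF x this]
  have "((\<lambda>s. H (x s)) has_real_derivative ?D) (at t within T)"
    by (simp add: o_def has_real_derivative_iff_has_vector_derivative)
  then have "((\<lambda>s. H (x s) - c) has_real_derivative ?D) (at t within T)"
    by (auto intro!: derivative_eq_intros)
  moreover have "?D \<le> u t \<bullet> ph_output B H (x t)"
    using J[OF X] R[OF X] by (rule ph_power_balance)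
  ultimately show "\<exists>D. ((\<lambda>s. H (x s) - c) has_real_derivative D) (at t within T)
      \<and> D \<le> u t \<bullet> ph_output B H (x t)"
    by blast
qed

theorem mainTheorem3:
  fixes e :: "real^'N \<Rightarrow> real^'r" and d :: "real^'r \<Rightarrow> real^'N"
    and J R :: "real^'r \<Rightarrow> real^'r^'r" and B :: "real^'r \<Rightarrow> real^'p^'r"
    and H :: "real^'r \<Rightarrow> real" and H_min t_end :: real
  assumes "t_end > 0"
    and "C1_map e" and "C1_map d" and "\<forall>\<zeta>. e (d \<zeta>) = \<zeta>"
    and "ph_system J R B H"
    and "\<forall>\<zeta>. H \<zeta> \<ge> H_min"
  shows "is_passive {0..t_end} (range d) (recon_rhs e d J R B H) (recon_output e d B H)
           (\<lambda>\<xi>. (H \<circ> e) \<xi> - H_min)"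
proof (rule ph_passive)
  fix \<xi> :: "real^'N" and v :: "real^'N"
  show "(H \<circ> e) differentiable (at \<xi>)"
    using assms by (intro differentiable_chain_at) (auto simp: C1_map_def ph_system_def)
  have J: "J (e \<xi>) = - transpose (J (e \<xi>))" and R: "pos_semidef (R (e \<xi>))"
    using assms by (auto simp only: ph_system_def)
  show "v \<bullet> (recon_matrix e d J \<xi> *v v) = 0"
    by (simp only: recon_matrix_def Let_def congruence_quadratic_form skew_quadratic_form[OF J])
  show "0 \<le> v \<bullet> (recon_matrix e d R \<xi> *v v)"
    using R by (simp only: recon_matrix_def Let_def congruence_quadratic_form pos_semidef_def)
  show "H_min \<le> (H \<circ> e) \<xi>"
    using assms by simp
qed

end
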